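(* Let $\mathcal{R}$ be right amenable, let $\mathcal{F} = (F_i)_{i \in I}$ be a right Følner net in $\mathcal{R}$, let $X$ be a strongly irreducible subshift of $Q^M$ of finite type, let $Y$ be a subshift of $Q^M$, and let $\Delta$ be a local map from $X$ to $Y$ such that $\mathrm{ent}_{\mathcal{F}}(\Delta(X)) < \mathrm{ent}_{\mathcal{F}}(X)$. Then the map $\Delta$ is not pre-injective.
   Context: Setting. A group $G$ acts transitively from the left on a non-empty set $M$; the action is written $(g,m)\mapsto g\triangleright m$. An element $m_0\in M$ and, for each $m\in M$, an element $g_{m_0,m}\in G$ with $g_{m_0,m}\triangleright m_0=m$ are fixed; $\mathcal{R}=((M,G,\triangleright),(m_0,(g_{m_0,m})_{m\in M}))$ is called a cell space. The stabiliser $G_0$ of $m_0$ is finite. The right semi-action of $G/G_0$ on $M$ is $m\triangleleft gG_0=g_{m_0,m}g\triangleright m_0$. Identify $M$ with $G/G_0$ via $m\mapsto\{g\in G: g\triangleright m_0=m\}$; then $m\triangleleft n=g_{m_0,m}\triangleright n$ for $m,n\in M$. For $A\subseteq M$, $A\triangleleft\mathfrak{g}=\{a\triangleleft\mathfrak{g}: a\in A\}$. $\mathcal{R}$ is finitely right generated, and $S$ is a fixed finite symmetric right generating set: a finite $S\subseteq G/G_0$ with $G_0\cdot S\subseteq S$ and $S^{-1}:=\{g^{-1}G_0: s\in S,\ g\in s\}\subseteq S$ such that each $m\in M$ has the form $(((m_0\triangleleft s_1)\triangleleft s_2)\cdots)\triangleleft s_k$ with $k\ge 0$, $s_i\in S$.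 $d$ is the path metric on $M$ of the graph with an edge from $m$ to $m\triangleleft s$ for $m\in M$, $s\in S$. $\mathbb{B}(m,\rho)=\{m'\in M: d(m,m')\le\rho\}$ and $\mathbb{B}(\rho)=\mathbb{B}(m_0,\rho)$ for $\rho\in\mathbb{N}_0$. For $A,B\subseteq M$, $d(A,B)=\inf\{d(a,b): a\in A, b\in B\}$ (with $\inf\emptyset=\infty$). For $A\subseteq M$ and $\theta\in\mathbb{N}_0$: $A^{-\theta}=\{m\in A:\mathbb{B}(m,\theta)\subseteq A\}$, $A^{+\theta}=\{m\in M:\mathbb{B}(m,\theta)\cap A\neq\emptyset\}$, $\partial_\theta A=A^{+\theta}\setminus A^{-\theta}$. $H$ is a fixed subgroup of $G$ containing all $g_{m_0,m}$, $m\in M$; $H_0=H\cap G_0$. $Q$ is a finite set. Patterns and subshifts. For $A\subseteq M$, an $A$-pattern is a map $p\colon A\to Q$, with domain $\mathrm{dom}(p)=A$; it is finite if $A$ is finite. For $g\in G$, $g\blacktriangleright p\colon g\triangleright A\to Q$, $m\mapsto p(g^{-1}\triangleright m)$. An $A$-pattern $p$ semi-occurs in an $A'$-pattern $p'$ if there is $h\in H$ with $h\triangleright A\subseteq A'$ and $h\blacktriangleright p=p'|_{h\triangleright A}$. For a set $\mathfrak{F}$ of finite patterns, $\langle\mathfrak{F}\rangle$ is the set of $c\in Q^M$ in which no $\mathfrak{f}\in\mathfrak{F}$ semi-occurs. A subset $X\subseteq Q^M$ is a subshift of $Q^M$ if $X=\langle\mathfrak{F}\rangle$ for some set $\mathfrak{F}$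 of finite patterns; it is of finite type if $\mathfrak{F}$ can be chosen finite. A pattern is allowed in $X$ if it semi-occurs in some $x\in X$. For $X\subseteq Q^M$ and $A\subseteq M$, $X_A=\{x|_A: x\in X\}$. A subshift $X$ is $\kappa$-strongly irreducible ($\kappa\in\mathbb{N}_0$) if for all finite patterns $p,p'$ allowed in $X$ with $d(\mathrm{dom}(p),\mathrm{dom}(p'))\ge\kappa+1$ there is $x\in X$ with $x|_{\mathrm{dom}(p)}=p$ and $x|_{\mathrm{dom}(p')}=p'$; it is strongly irreducible if it is so for some $\kappa$. Local maps. For subshifts $X,Y$, a map $\Delta\colon X\to Y$ is $\kappa$-local if there are $N\subseteq\mathbb{B}(\kappa)$ with $G_0\triangleright N\subseteq N$ and $\delta\colon X_N\to Q$ with $\delta(h_0\blacktriangleright\ell)=\delta(\ell)$ for all $h_0\in H_0$, $\ell\in X_N$, such that $\Delta(x)(m)=\delta(n\mapsto x(m\triangleleft n))$ for all $x\in X$, $m\in M$; it is local if it is $\kappa$-local for some $\kappa\in\mathbb{N}_0$. $\Delta$ is pre-injective if for all $x,x'\in X$ such that $\{m: x(m)\ne x'(m)\}$ is finite and $\Delta(x)=\Delta(x')$, one has $x=x'$. Amenability and entropy. $\mathcal{R}$ is right amenable if there is a finitely additive probability measure $\mu$ on all subsets of $M$ such that $\mu(A\triangleleft\mathfrak{g})=\mu(A)$ for all $\mathfrak{g}\in G/G_0$ and all $A\subseteq M$ on which $m\mapsto m\triangleleft\mathfrak{g}$ is injective; since $G_0$ is finite, this is equivalent to the existence of a right Følner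 net, i.e. a net $(F_i)_{i\in I}$ of non-empty finite subsets of $M$ with $\lim_{i\in I}|\partial_\rho F_i|/|F_i|=0$ for every $\rho\in\mathbb{N}_0$. For such a net $\mathcal{F}$ and $X\subseteq Q^M$, the entropy is $\mathrm{ent}_{\mathcal{F}}(X)=\limsup_{i\in I}\log|X_{F_i}|/|F_i|$ (with $\log 0=-\infty$). *)

theory Defs
  imports
    "HOL-Analysis.Measure_Space"
    "HOL-Algebra.Group_Action"
    "HOL-Algebra.Left_Coset"
    "HOL-Library.Extended_Nat"
    "HOL-Library.Extended_Real"
begin

section \<open>Cell spaces\<close>

text \<open>
  The field \<open>coord\<close> sends a cell \<open>m\<close> to the chosen group element that moves the
  origin \<open>m0\<close> to \<open>m\<close>, written with the index \<open>m0, m\<close> in the literature.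
\<close>

record ('g, 'm) cell_space_data =
  grp :: "'g monoid"
  cells :: "'m set"
  act :: "'g \<Rightarrow> 'm \<Rightarrow> 'm"
  origin :: 'm
  coord :: "'m \<Rightarrow> 'g"

locale cell_space =
  fixes R :: "('g, 'm) cell_space_data" (structure)
  assumes transitive: "transitive_action (grp R) (cells R) (act R)"
    and origin_closed: "origin R \<in> cells R"
    and coord_closed: "m \<in> cells R \<Longrightarrow> coord R m \<in> carrier (grp R)"
    and coord_act: "m \<in> cells R \<Longrightarrow> act R (coord R m) (origin R) = m"

definition origin_stabilizer :: "('g, 'm) cell_space_data \<Rightarrow> 'g set" where
  "origin_stabilizer R = stabilizer (grp R) (act R) (origin R)"

definition coset_space :: "('g, 'm) cell_space_data \<Rightarrow> 'g set set" where
  "coset_space R = lcosets\<^bsub>grp R\<^esub> (origin_stabilizer R)"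

text \<open>
  The second argument is a left coset of the stabiliser; the choice of a representative
  is irrelevant, see \<open>right_act_coset\<close> below.
\<close>

definition right_act ::
    "('g, 'm) cell_space_data \<Rightarrow> 'm \<Rightarrow> 'g set \<Rightarrow> 'm" (infixl \<open>\<triangleleft>\<index>\<close> 70) where
  "m \<triangleleft>\<^bsub>R\<^esub> C = act R (coord R m \<otimes>\<^bsub>grp R\<^esub> (SOME g. g \<in> C)) (origin R)"

text \<open>The bijection by which cells are identified with left cosets of the stabiliser.\<close>

definition coset_of_cell :: "('g, 'm) cell_space_data \<Rightarrow> 'm \<Rightarrow> 'g set" where
  "coset_of_cell R m = {g \<in> carrier (grp R). act R g (origin R) = m}"

lemma (in cell_space) right_act_coset:
  assumes "m \<in> cells R" and "g \<in> carrier (grp R)"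
  shows "m \<triangleleft>\<^bsub>R\<^esub> (g <#\<^bsub>grp R\<^esub> origin_stabilizer R) = act R (coord R m \<otimes>\<^bsub>grp R\<^esub> g) (origin R)"
proof -
  interpret A: transitive_action "grp R" "cells R" "act R" by (rule transitive)
  interpret group "grp R" using A.group_hom by (simp add: group_hom_def)
  let ?C = "g <#\<^bsub>grp R\<^esub> origin_stabilizer R"
  have sub: "subgroup (origin_stabilizer R) (grp R)"
    unfolding origin_stabilizer_def using A.stabilizer_subgroup origin_closed by blast
  have "g \<in> ?C" by (rule lcos_self[OF assms(2) sub])
  then have "(SOME k. k \<in> ?C) \<in> ?C" by (rule someI)
  then obtain k where k: "k \<in> origin_stabilizer R" "(SOME k. k \<in> ?C) = g \<otimes>\<^bsub>grp R\<^esub> k"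
    unfolding l_coset_def by blast
  have kc: "k \<in> carrier (grp R)" and ko: "act R k (origin R) = origin R"
    using k(1) by (auto simp: origin_stabilizer_def stabilizer_def)
  show ?thesis
    unfolding right_act_def k(2)
    using assms kc ko coord_closed[OF assms(1)] origin_closed
    by (simp add: A.composition_rule m_assoc[symmetric])
qed

lemma (in cell_space) right_act_coset_of_cell:
  assumes "m \<in> cells R" and "n \<in> cells R"
  shows "m \<triangleleft>\<^bsub>R\<^esub> coset_of_cell R n = act R (coord R m) n"
proof -
  interpret A: transitive_action "grp R" "cells R" "act R" by (rule transitive)
  have "coord R n \<in> coset_of_cell R n"
    using assms(2) coord_closed coord_act by (simp add: coset_of_cell_def)
  then have "(SOME g. g \<in> coset_of_cell R n) \<in> coset_of_cell R n" by (rule someI)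
  then show ?thesis
    using A.composition_rule[OF origin_closed coord_closed[OF assms(1)]]
    by (auto simp: right_act_def coset_of_cell_def)
qed

definition right_amenable :: "('g, 'm) cell_space_data \<Rightarrow> bool" where
  "right_amenable R \<longleftrightarrow>
    (\<exists>\<mu> :: 'm set \<Rightarrow> real.
       (\<forall>A. A \<subseteq> cells R \<longrightarrow> \<mu> A \<ge> 0) \<and> \<mu> (cells R) = 1 \<and>
       Measure_Space.additive (Pow (cells R)) \<mu> \<and>
       (\<forall>C \<in> coset_space R. \<forall>A. A \<subseteq> cells R \<longrightarrow> inj_on (\<lambda>m. m \<triangleleft>\<^bsub>R\<^esub> C) A \<longrightarrow>
          \<mu> ((\<lambda>m. m \<triangleleft>\<^bsub>R\<^esub> C) ` A) = \<mu> A))"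


section \<open>Generating sets and the induced metric\<close>

definition right_generating_set :: "('g, 'm) cell_space_data \<Rightarrow> 'g set set \<Rightarrow> bool" where
  "right_generating_set R S \<longleftrightarrow>
    S \<subseteq> coset_space R \<and>
    (\<forall>g0 \<in> origin_stabilizer R. \<forall>s \<in> S. g0 <#\<^bsub>grp R\<^esub> s \<in> S) \<and>
    (\<forall>m \<in> cells R. \<exists>ss. set ss \<subseteq> S \<and> m = foldl (\<lambda>n s. n \<triangleleft>\<^bsub>R\<^esub> s) (origin R) ss)"

definition symmetric_set :: "('g, 'm) cell_space_data \<Rightarrow> 'g set set \<Rightarrow> bool" where
  "symmetric_set R S \<longleftrightarrow>
    {(inv\<^bsub>grp R\<^esub> g) <#\<^bsub>grp R\<^esub> origin_stabilizer R | s g. s \<in> S \<and> g \<in> s} \<subseteq> S"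

text \<open>
  If \<open>S\<close> is symmetric and stable under the stabiliser, then the edge relation is symmetric,
  so directed and undirected paths have the same lengths.
\<close>

definition edges :: "('g, 'm) cell_space_data \<Rightarrow> 'g set set \<Rightarrow> 'm rel" where
  "edges R S = {(m, m \<triangleleft>\<^bsub>R\<^esub> s) | m s. m \<in> cells R \<and> s \<in> S}"

definition cell_dist :: "('g, 'm) cell_space_data \<Rightarrow> 'g set set \<Rightarrow> 'm \<Rightarrow> 'm \<Rightarrow> enat" where
  "cell_dist R S m m' = (INF k \<in> {k. (m, m') \<in> edges R S ^^ k}. enat k)"

definition cell_setdist ::
    "('g, 'm) cell_space_data \<Rightarrow> 'g set set \<Rightarrow> 'm set \<Rightarrow> 'm set \<Rightarrow> enat" where
  "cell_setdist R S A B = (INF a \<in> A. INF b \<in> B. cell_dist R S a b)"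

definition cell_ball :: "('g, 'm) cell_space_data \<Rightarrow> 'g set set \<Rightarrow> 'm \<Rightarrow> nat \<Rightarrow> 'm set" where
  "cell_ball R S m \<rho> = {m' \<in> cells R. cell_dist R S m m' \<le> enat \<rho>}"

definition set_interior ::
    "('g, 'm) cell_space_data \<Rightarrow> 'g set set \<Rightarrow> nat \<Rightarrow> 'm set \<Rightarrow> 'm set" where
  "set_interior R S \<theta> A = {m \<in> A. cell_ball R S m \<theta> \<subseteq> A}"

definition set_closure ::
    "('g, 'm) cell_space_data \<Rightarrow> 'g set set \<Rightarrow> nat \<Rightarrow> 'm set \<Rightarrow> 'm set" where
  "set_closure R S \<theta> A = {m \<in> cells R. cell_ball R S m \<theta> \<inter> A \<noteq> {}}"

definition set_boundary ::
    "('g, 'm) cell_space_data \<Rightarrow> 'g set set \<Rightarrow> nat \<Rightarrow> 'm set \<Rightarrow> 'm set" where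
  "set_boundary R S \<theta> A = set_closure R S \<theta> A - set_interior R S \<theta> A"


section \<open>Nets\<close>

definition directed_set :: "'i set \<Rightarrow> 'i rel \<Rightarrow> bool" where
  "directed_set I r \<longleftrightarrow>
    I \<noteq> {} \<and> preorder_on I r \<and> (\<forall>i \<in> I. \<forall>j \<in> I. \<exists>k \<in> I. (i, k) \<in> r \<and> (j, k) \<in> r)"

text \<open>
  The filter generated by the tails of the directed set, so that limits and limits superior
  along it are those of nets indexed by \<open>I\<close>.
\<close>

definition net_filter :: "'i set \<Rightarrow> 'i rel \<Rightarrow> 'i filter" where
  "net_filter I r = (INF i \<in> I. principal {j \<in> I. (i, j) \<in> r})"

lemma eventually_net_filter:
  assumes "directed_set I r"
  shows "eventually P (net_filter I r) \<longleftrightarrow> (\<exists>i \<in> I. \<forall>j \<in> I. (i, j) \<in> r \<longrightarrow> P j)"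
proof -
  let ?T = "\<lambda>i. {j \<in> I. (i, j) \<in> r}"
  have tr: "trans r" and ne: "I \<noteq> {}"
    using assms by (simp_all add: directed_set_def preorder_on_def)
  have "\<exists>k \<in> I. principal (?T k) \<le> inf (principal (?T i)) (principal (?T j))"
    if ij: "i \<in> I" "j \<in> I" for i j
  proof -
    obtain k where k: "k \<in> I" "(i, k) \<in> r" "(j, k) \<in> r"
      using assms ij unfolding directed_set_def by meson
    have "?T k \<subseteq> ?T i \<inter> ?T j"
      using transD[OF tr k(2)] transD[OF tr k(3)] by blast
    then show ?thesis using k(1) by (auto simp only: inf_principal principal_le_iff)
  qed
  then have "eventually P (net_filter I r) \<longleftrightarrow> (\<exists>i \<in> I. eventually P (principal (?T i)))"
    unfolding net_filter_def by (rule eventually_INF_base[OF ne])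
  then show ?thesis unfolding eventually_principal by blast
qed

definition right_Folner_net ::
    "('g, 'm) cell_space_data \<Rightarrow> 'g set set \<Rightarrow> 'i set \<Rightarrow> 'i rel \<Rightarrow> ('i \<Rightarrow> 'm set) \<Rightarrow> bool" where
  "right_Folner_net R S I r F \<longleftrightarrow>
    directed_set I r \<and>
    (\<forall>i \<in> I. F i \<noteq> {} \<and> finite (F i) \<and> F i \<subseteq> cells R) \<and>
    (\<forall>\<rho>. ((\<lambda>i. real (card (set_boundary R S \<rho> (F i))) / real (card (F i))) \<longlongrightarrow> 0)
           (net_filter I r))"


section \<open>Patterns and subshifts\<close>

text \<open>
  A pattern with domain \<open>A\<close> is a partial map \<open>p\<close> with \<open>dom p = A\<close>, so that a pattern carries
  its domain and the restriction of \<open>p\<close> to \<open>B\<close> is \<open>p |` B\<close>.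
\<close>

definition patterns :: "('g, 'm) cell_space_data \<Rightarrow> 'q set \<Rightarrow> ('m \<rightharpoonup> 'q) set" where
  "patterns R Q = {p. dom p \<subseteq> cells R \<and> ran p \<subseteq> Q}"

definition finite_patterns :: "('g, 'm) cell_space_data \<Rightarrow> 'q set \<Rightarrow> ('m \<rightharpoonup> 'q) set" where
  "finite_patterns R Q = {p \<in> patterns R Q. finite (dom p)}"

definition configurations :: "('g, 'm) cell_space_data \<Rightarrow> 'q set \<Rightarrow> ('m \<rightharpoonup> 'q) set" where
  "configurations R Q = {c \<in> patterns R Q. dom c = cells R}"

definition shift :: "('g, 'm) cell_space_data \<Rightarrow> 'g \<Rightarrow> ('m \<rightharpoonup> 'q) \<Rightarrow> ('m \<rightharpoonup> 'q)" where
  "shift R g p = (\<lambda>m. if m \<in> act R g ` dom p then p (act R (inv\<^bsub>grp R\<^esub> g) m) else None)"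

definition semi_occurs ::
    "('g, 'm) cell_space_data \<Rightarrow> 'g set \<Rightarrow> ('m \<rightharpoonup> 'q) \<Rightarrow> ('m \<rightharpoonup> 'q) \<Rightarrow> bool" where
  "semi_occurs R H p p' \<longleftrightarrow>
    (\<exists>h \<in> H. act R h ` dom p \<subseteq> dom p' \<and> shift R h p = p' |` (act R h ` dom p))"

definition avoiding ::
    "('g, 'm) cell_space_data \<Rightarrow> 'g set \<Rightarrow> 'q set \<Rightarrow> ('m \<rightharpoonup> 'q) set \<Rightarrow> ('m \<rightharpoonup> 'q) set" where
  "avoiding R H Q \<FF> = {c \<in> configurations R Q. \<forall>f \<in> \<FF>. \<not> semi_occurs R H f c}"

definition subshift ::
    "('g, 'm) cell_space_data \<Rightarrow> 'g set \<Rightarrow> 'q set \<Rightarrow> ('m \<rightharpoonup> 'q) set \<Rightarrow> bool" where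
  "subshift R H Q X \<longleftrightarrow> (\<exists>\<FF>. \<FF> \<subseteq> finite_patterns R Q \<and> X = avoiding R H Q \<FF>)"

definition subshift_of_finite_type ::
    "('g, 'm) cell_space_data \<Rightarrow> 'g set \<Rightarrow> 'q set \<Rightarrow> ('m \<rightharpoonup> 'q) set \<Rightarrow> bool" where
  "subshift_of_finite_type R H Q X \<longleftrightarrow>
    (\<exists>\<FF>. finite \<FF> \<and> \<FF> \<subseteq> finite_patterns R Q \<and> X = avoiding R H Q \<FF>)"

definition allowed ::
    "('g, 'm) cell_space_data \<Rightarrow> 'g set \<Rightarrow> ('m \<rightharpoonup> 'q) set \<Rightarrow> ('m \<rightharpoonup> 'q) \<Rightarrow> bool" where
  "allowed R H X p \<longleftrightarrow> (\<exists>x \<in> X. semi_occurs R H p x)"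

definition restrictions :: "('m \<rightharpoonup> 'q) set \<Rightarrow> 'm set \<Rightarrow> ('m \<rightharpoonup> 'q) set" where
  "restrictions X A = (\<lambda>x. x |` A) ` X"

definition strongly_irreducible_with ::
    "('g, 'm) cell_space_data \<Rightarrow> 'g set set \<Rightarrow> 'g set \<Rightarrow> 'q set \<Rightarrow> nat \<Rightarrow> ('m \<rightharpoonup> 'q) set \<Rightarrow> bool" where
  "strongly_irreducible_with R S H Q \<kappa> X \<longleftrightarrow>
    (\<forall>p \<in> finite_patterns R Q. \<forall>p' \<in> finite_patterns R Q.
       allowed R H X p \<longrightarrow> allowed R H X p' \<longrightarrow>
       cell_setdist R S (dom p) (dom p') \<ge> enat (\<kappa> + 1) \<longrightarrow>
       (\<exists>x \<in> X. x |` dom p = p \<and> x |` dom p' = p'))"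

definition strongly_irreducible ::
    "('g, 'm) cell_space_data \<Rightarrow> 'g set set \<Rightarrow> 'g set \<Rightarrow> 'q set \<Rightarrow> ('m \<rightharpoonup> 'q) set \<Rightarrow> bool" where
  "strongly_irreducible R S H Q X \<longleftrightarrow> (\<exists>\<kappa>. strongly_irreducible_with R S H Q \<kappa> X)"


section \<open>Local maps and entropy\<close>

definition local_map_with ::
    "('g, 'm) cell_space_data \<Rightarrow> 'g set set \<Rightarrow> 'g set \<Rightarrow> 'q set \<Rightarrow> nat \<Rightarrow>
     ('m \<rightharpoonup> 'q) set \<Rightarrow> ('m \<rightharpoonup> 'q) set \<Rightarrow> (('m \<rightharpoonup> 'q) \<Rightarrow> ('m \<rightharpoonup> 'q)) \<Rightarrow> bool" where
  "local_map_with R S H Q \<kappa> X Y \<Delta> \<longleftrightarrow>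
    \<Delta> \<in> X \<rightarrow> Y \<and>
    (\<exists>N \<delta>.
       N \<subseteq> cell_ball R S (origin R) \<kappa> \<and>
       (\<forall>g0 \<in> origin_stabilizer R. act R g0 ` N \<subseteq> N) \<and>
       \<delta> \<in> restrictions X N \<rightarrow> Q \<and>
       (\<forall>h0 \<in> H \<inter> origin_stabilizer R. \<forall>l \<in> restrictions X N. \<delta> (shift R h0 l) = \<delta> l) \<and>
       (\<forall>x \<in> X. \<forall>m \<in> cells R.
          \<Delta> x m = Some (\<delta> (\<lambda>n. if n \<in> N then x (m \<triangleleft>\<^bsub>R\<^esub> coset_of_cell R n) else None))))"

definition local_map ::
    "('g, 'm) cell_space_data \<Rightarrow> 'g set set \<Rightarrow> 'g set \<Rightarrow> 'q set \<Rightarrow>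
     ('m \<rightharpoonup> 'q) set \<Rightarrow> ('m \<rightharpoonup> 'q) set \<Rightarrow> (('m \<rightharpoonup> 'q) \<Rightarrow> ('m \<rightharpoonup> 'q)) \<Rightarrow> bool" where
  "local_map R S H Q X Y \<Delta> \<longleftrightarrow> (\<exists>\<kappa>. local_map_with R S H Q \<kappa> X Y \<Delta>)"

definition pre_injective ::
    "('g, 'm) cell_space_data \<Rightarrow> ('m \<rightharpoonup> 'q) set \<Rightarrow> (('m \<rightharpoonup> 'q) \<Rightarrow> ('m \<rightharpoonup> 'q)) \<Rightarrow> bool" where
  "pre_injective R X \<Delta> \<longleftrightarrow>
    (\<forall>x \<in> X. \<forall>x' \<in> X. finite {m \<in> cells R. x m \<noteq> x' m} \<longrightarrow> \<Delta> x = \<Delta> x' \<longrightarrow> x = x')"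

definition log_card :: "'a set \<Rightarrow> ereal" where
  "log_card A = (if A = {} then - \<infinity> else ereal (ln (real (card A))))"

definition entropy :: "'i set \<Rightarrow> 'i rel \<Rightarrow> ('i \<Rightarrow> 'm set) \<Rightarrow> ('m \<rightharpoonup> 'q) set \<Rightarrow> ereal" where
  "entropy I r F X =
    Limsup (net_filter I r) (\<lambda>i. log_card (restrictions X (F i)) / ereal (real (card (F i))))"

end

theory Submission
  imports Defs
begin

text \<open>
  Fix a configuration \<open>x\<^sub>0\<close> of \<open>X\<close>. Since \<open>X\<close> is strongly irreducible and of finite type,
  every pattern of \<open>X\<close> on a finite set \<open>A\<close> extends to a configuration of \<open>X\<close> that agrees with
  \<open>x\<^sub>0\<close> outside a fixed thickening of \<open>A\<close>. If \<open>\<Delta>\<close> is pre-injective, then the images under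
  \<open>\<Delta>\<close> of these extensions are pairwise distinct, and they agree with \<open>\<Delta> x\<^sub>0\<close> outside a larger
  thickening \<open>B\<close> of \<open>A\<close>; hence \<open>X\<close> has at most as many patterns on \<open>A\<close> as \<open>\<Delta> ` X\<close> has on \<open>B\<close>,
  that is, at most \<open>card Q ^ card (B - A)\<close> times as many as \<open>\<Delta> ` X\<close> has on \<open>A\<close>. For \<open>A = F i\<close> the
  extra factor is negligible in the limit, so the entropy of \<open>X\<close> is at most that of \<open>\<Delta> ` X\<close>.
\<close>

section \<open>The action and the metric\<close>

context cell_space
begin

sublocale A: transitive_action "grp R" "cells R" "act R"
  by (rule transitive)

sublocale G: group "grp R"
  using A.group_hom by (simp add: group_hom_def)

lemma act_closed: "g \<in> carrier (grp R) \<Longrightarrow> m \<in> cells R \<Longrightarrow> act R g m \<in> cells R"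
  using A.element_image by blast

lemma act_one: "m \<in> cells R \<Longrightarrow> act R \<one>\<^bsub>grp R\<^esub> m = m"
  using A.id_eq_one by (metis restrict_apply')

lemma act_inv_act: "g \<in> carrier (grp R) \<Longrightarrow> m \<in> cells R \<Longrightarrow> act R (inv\<^bsub>grp R\<^esub> g) (act R g m) = m"
  using A.orbit_sym_aux by blast

lemma act_act_inv: "g \<in> carrier (grp R) \<Longrightarrow> m \<in> cells R \<Longrightarrow> act R g (act R (inv\<^bsub>grp R\<^esub> g) m) = m"
  using act_inv_act[of "inv\<^bsub>grp R\<^esub> g" m] by simp

text \<open>Multiplying by \<open>coord R n\<close> on the right and by the inverse of
  \<open>coord R m\<close> on the left embeds the set of elements taking \<open>n\<close> to
  \<open>m\<close> into the stabiliser of the origin.\<close>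

lemma finite_transporter:
  assumes fin: "finite (origin_stabilizer R)" and "m \<in> cells R" "n \<in> cells R"
  shows "finite {h \<in> carrier (grp R). act R h n = m}" (is "finite ?T")
proof -
  let ?f = "\<lambda>h. inv\<^bsub>grp R\<^esub> coord R m \<otimes>\<^bsub>grp R\<^esub> (h \<otimes>\<^bsub>grp R\<^esub> coord R n)"
  note c = assms(2,3)[THEN coord_closed]
  have "inj_on ?f ?T"
  proof (rule inj_onI)
    fix h k assume "h \<in> ?T" "k \<in> ?T" and eq: "?f h = ?f k"
    then have "h \<in> carrier (grp R)" "k \<in> carrier (grp R)" by blast+
    with eq c show "h = k" by simp
  qed
  moreover have "?f ` ?T \<subseteq> origin_stabilizer R"
  proof
    fix k assume "k \<in> ?f ` ?T"
    then obtain h where h: "h \<in> carrier (grp R)" "act R h n = m" and k: "k = ?f h" by blast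
    have "act R k (origin R) = act R (inv\<^bsub>grp R\<^esub> coord R m) m"
      using c h k by (simp add: A.composition_rule origin_closed coord_act assms)
    also have "\<dots> = origin R"
      using act_inv_act[OF c(1) origin_closed] by (simp add: coord_act assms)
    finally show "k \<in> origin_stabilizer R"
      using c h k by (simp add: origin_stabilizer_def stabilizer_def)
  qed
  ultimately show ?thesis
    using fin by (meson finite_imageD finite_subset)
qed

text \<open>Stability of \<open>S\<close> under the stabiliser makes left translations graph automorphisms.\<close>

lemma edges_act:
  assumes S: "right_generating_set R S" and g: "g \<in> carrier (grp R)"
    and e: "(m, m') \<in> edges R S"
  shows "(act R g m, act R g m') \<in> edges R S"
proof -
  obtain s where s: "m \<in> cells R" "s \<in> S" "m' = m \<triangleleft>\<^bsub>R\<^esub> s"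
    using e by (auto simp: edges_def)
  obtain a where a: "a \<in> carrier (grp R)" "s = a <#\<^bsub>grp R\<^esub> origin_stabilizer R"
    using s(2) S by (auto simp: right_generating_set_def coset_space_def LCOSETS_def)
  let ?n = "act R g m"
  \<comment> \<open>Coordinates need not be equivariant: the product of \<open>g\<close> and
    \<open>coord R m\<close> takes the origin to \<open>?n\<close>, as does
    \<open>coord R ?n\<close>, and \<open>?k\<close> measures the discrepancy. It fixes the origin,
    so the translated edge is again an edge, with label \<open>?k\<close> times
    \<open>s\<close>.\<close>
  let ?k = "inv\<^bsub>grp R\<^esub> coord R ?n \<otimes>\<^bsub>grp R\<^esub> (g \<otimes>\<^bsub>grp R\<^esub> coord R m)"
  have n: "?n \<in> cells R" using g s(1) by (rule act_closed)
  note c = coord_closed[OF n] coord_closed[OF s(1)]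
  have "act R ?k (origin R) = act R (inv\<^bsub>grp R\<^esub> coord R ?n) (act R (coord R ?n) (origin R))"
    using c g by (simp add: A.composition_rule origin_closed coord_act s n)
  then have k: "?k \<in> origin_stabilizer R"
    using c g by (simp add: origin_stabilizer_def stabilizer_def act_inv_act origin_closed)
  have "origin_stabilizer R \<subseteq> carrier (grp R)"
    by (auto simp: origin_stabilizer_def stabilizer_def)
  then have ks: "?k <#\<^bsub>grp R\<^esub> s = (?k \<otimes>\<^bsub>grp R\<^esub> a) <#\<^bsub>grp R\<^esub> origin_stabilizer R"
    using a c g by (simp add: G.lcos_m_assoc)
  have "?k <#\<^bsub>grp R\<^esub> s \<in> S"
    using S k s(2) by (simp add: right_generating_set_def)
  moreover have "coord R ?n \<otimes>\<^bsub>grp R\<^esub> (?k \<otimes>\<^bsub>grp R\<^esub> a) = g \<otimes>\<^bsub>grp R\<^esub> (coord R m \<otimes>\<^bsub>grp R\<^esub> a)"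
    using a c g by (simp add: G.m_assoc[symmetric])
  then have "?n \<triangleleft>\<^bsub>R\<^esub> (?k <#\<^bsub>grp R\<^esub> s) = act R g m'"
    using a c g s unfolding ks
    by (simp add: right_act_coset n A.composition_rule origin_closed act_closed)
  ultimately show ?thesis
    using n unfolding edges_def
    by (intro CollectI exI[of _ ?n] exI[of _ "?k <#\<^bsub>grp R\<^esub> s"]) simp
qed

lemma relpow_edges_act:
  assumes "right_generating_set R S" "g \<in> carrier (grp R)" "(m, m') \<in> edges R S ^^ k"
  shows "(act R g m, act R g m') \<in> edges R S ^^ k"
  using assms(3)
proof (induction k arbitrary: m')
  case (Suc k)
  then show ?case using edges_act[OF assms(1,2)] by (auto intro!: relcompI)
qed simp

end

section \<open>Distances in terms of paths, and thickenings of sets of cells\<close>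

lemma cell_dist_le_iff:
  "cell_dist R S m m' \<le> enat k \<longleftrightarrow> (\<exists>j\<le>k. (m, m') \<in> edges R S ^^ j)"
proof
  let ?D = "enat ` {k. (m, m') \<in> edges R S ^^ k}"
  assume le: "cell_dist R S m m' \<le> enat k"
  \<comment> \<open>Only an empty set of path lengths has infimum \<open>\<infinity>\<close>. A
    nonempty one attains its infimum by well-ordering, which yields an actual path.\<close>
  have "?D \<noteq> {}"
  proof
    assume "?D = {}"
    then have "cell_dist R S m m' = \<infinity>"
      unfolding cell_dist_def by (simp only: Inf_empty top_enat_def)
    with le show False by simp
  qed
  then have "Inf ?D \<in> ?D"
    by (metis ex_in_conv wellorder_InfI)
  then obtain j where "Inf ?D = enat j" "(m, m') \<in> edges R S ^^ j"
    by blast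
  then show "\<exists>j\<le>k. (m, m') \<in> edges R S ^^ j"
    using le by (auto simp: cell_dist_def)
next
  assume "\<exists>j\<le>k. (m, m') \<in> edges R S ^^ j"
  then show "cell_dist R S m m' \<le> enat k"
    unfolding cell_dist_def by (auto intro: INF_lower2)
qed

lemma cell_dist_triangle:
  assumes "cell_dist R S a b \<le> enat k" "cell_dist R S b c \<le> enat l"
  shows "cell_dist R S a c \<le> enat (k + l)"
proof -
  obtain i j where "i \<le> k" "(a, b) \<in> edges R S ^^ i" "j \<le> l" "(b, c) \<in> edges R S ^^ j"
    using assms by (auto simp: cell_dist_le_iff)
  then have "(a, c) \<in> edges R S ^^ (i + j)" "i + j \<le> k + l"
    unfolding relpow_add by auto
  then show ?thesis unfolding cell_dist_le_iff by blast
qed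

lemma cell_dist_refl: "cell_dist R S a a \<le> enat k"
  unfolding cell_dist_le_iff by (rule exI[of _ 0]) simp

lemma subset_set_closure: "A \<subseteq> cells R \<Longrightarrow> A \<subseteq> set_closure R S \<theta> A"
  by (auto simp: set_closure_def cell_ball_def intro: cell_dist_refl)

lemma set_closure_subset: "set_closure R S \<theta> A \<subseteq> cells R"
  by (auto simp: set_closure_def)

text \<open>The triangle inequality. It allows the radii of strong irreducibility and of the local
  map to be added.\<close>

lemma set_closure_set_closure:
  "set_closure R S \<theta> (set_closure R S \<eta> A) \<subseteq> set_closure R S (\<theta> + \<eta>) A"
proof
  fix m assume "m \<in> set_closure R S \<theta> (set_closure R S \<eta> A)"
  then obtain n a where "m \<in> cells R" "cell_dist R S m n \<le> enat \<theta>"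
    "a \<in> cells R" "a \<in> A" "cell_dist R S n a \<le> enat \<eta>"
    by (auto simp: set_closure_def cell_ball_def)
  then show "m \<in> set_closure R S (\<theta> + \<eta>) A"
    using cell_dist_triangle[of R S m n \<theta> a \<eta>] by (auto simp: set_closure_def cell_ball_def)
qed

text \<open>In this cell-by-cell form, a map pasted together from two configurations is at once seen
  to be a configuration.\<close>

lemma configurations_iff:
  "c \<in> configurations R Q \<longleftrightarrow> (\<forall>m. if m \<in> cells R then \<exists>q\<in>Q. c m = Some q else c m = None)"
  (is "_ \<longleftrightarrow> ?rhs")
proof
  assume "c \<in> configurations R Q"
  then have d: "dom c = cells R" and Q: "ran c \<subseteq> Q"
    by (simp_all add: configurations_def patterns_def)
  show ?rhs
  proof
    fix m
    show "if m \<in> cells R then \<exists>q\<in>Q. c m = Some q else c m = None"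
      using Q unfolding d[symmetric] by (cases "c m") (auto intro: ranI)
  qed
next
  assume c: ?rhs
  have "m \<in> dom c \<longleftrightarrow> m \<in> cells R" for m
    using c[rule_format, of m] by (auto split: if_splits)
  then have "dom c = cells R" by blast
  moreover have "q \<in> Q" if "c m = Some q" for m q
    using c[rule_format, of m] that by (auto split: if_splits)
  then have "ran c \<subseteq> Q" by (auto simp: ran_def)
  ultimately show "c \<in> configurations R Q"
    by (simp add: configurations_def patterns_def)
qed

section \<open>Invariance of the distance under the action, and finiteness of thickenings\<close>

context cell_space
begin

lemma cell_dist_act:
  assumes "right_generating_set R S" "g \<in> carrier (grp R)" "cell_dist R S m m' \<le> enat k"
  shows "cell_dist R S (act R g m) (act R g m') \<le> enat k"
  using assms relpow_edges_act unfolding cell_dist_le_iff by blast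

text \<open>A cell has at most \<open>card S\<close> successors, so by induction finitely many cells
  are reached in \<open>j\<close> steps.\<close>

lemma finite_cell_ball:
  assumes "finite S"
  shows "finite (cell_ball R S m \<rho>)"
proof -
  have "finite ((edges R S ^^ j) `` {m})" for j
  proof (induction j)
    case (Suc j)
    have "(edges R S ^^ Suc j) `` {m}
        \<subseteq> (\<lambda>(n, s). n \<triangleleft>\<^bsub>R\<^esub> s) ` ((edges R S ^^ j) `` {m} \<times> S)"
      by (auto simp: edges_def image_iff)
    then show ?case
      by (rule finite_subset) (use Suc assms in simp)
  qed simp
  moreover have "cell_ball R S m \<rho> \<subseteq> (\<Union>j\<le>\<rho>. (edges R S ^^ j) `` {m})"
    by (auto simp: cell_ball_def cell_dist_le_iff)
  ultimately show ?thesis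
    by (meson finite_UN finite_atMost finite_subset)
qed

text \<open>For \<open>m\<close> in the thickening the distance is measured from \<open>m\<close> to
  some \<open>f\<close> in \<open>A\<close>. The inverse of \<open>coord R m\<close> moves
  \<open>m\<close> to the origin and \<open>f\<close> to a cell \<open>n\<close> of the finite ball
  there. Hence \<open>coord R m\<close> is one of the finitely many elements taking \<open>n\<close>
  to \<open>f\<close>, and it determines \<open>m\<close>.\<close>

lemma finite_set_closure:
  assumes "finite (origin_stabilizer R)" "finite S" "right_generating_set R S"
    and "finite A" "A \<subseteq> cells R"
  shows "finite (set_closure R S \<theta> A)"
proof -
  let ?B = "cell_ball R S (origin R) \<theta>"
  let ?T = "\<lambda>f n. {h \<in> carrier (grp R). act R h n = f}"
  have "set_closure R S \<theta> A \<subseteq> (\<Union>f\<in>A. \<Union>n\<in>?B. (\<lambda>h. act R h (origin R)) ` ?T f n)"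
  proof
    fix m assume "m \<in> set_closure R S \<theta> A"
    then obtain f where m: "m \<in> cells R" and f: "f \<in> A" "cell_dist R S m f \<le> enat \<theta>"
      by (auto simp: set_closure_def cell_ball_def)
    let ?n = "act R (inv\<^bsub>grp R\<^esub> coord R m) f"
    have fc: "f \<in> cells R" using f assms by blast
    have c: "coord R m \<in> carrier (grp R)" using m by (rule coord_closed)
    have "act R (inv\<^bsub>grp R\<^esub> coord R m) m = origin R"
      using act_inv_act[OF c origin_closed] m by (simp add: coord_act)
    then have "?n \<in> ?B"
      using cell_dist_act[OF assms(3) G.inv_closed[OF c] f(2)] c fc
      by (simp add: cell_ball_def act_closed)
    moreover have "coord R m \<in> ?T f ?n"
      using c fc by (simp add: act_act_inv)
    moreover have "m = act R (coord R m) (origin R)"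
      using m by (simp add: coord_act)
    ultimately show "m \<in> (\<Union>f\<in>A. \<Union>n\<in>?B. (\<lambda>h. act R h (origin R)) ` ?T f n)"
      using f(1) by blast
  qed
  moreover have "finite (\<Union>f\<in>A. \<Union>n\<in>?B. (\<lambda>h. act R h (origin R)) ` ?T f n)"
  proof (intro finite_UN_I finite_imageI finite_cell_ball assms(2,4))
    fix f n assume "f \<in> A" "n \<in> ?B"
    then show "finite (?T f n)"
      using assms(1,5) by (intro finite_transporter) (auto simp: cell_ball_def)
  qed
  ultimately show ?thesis by (rule finite_subset)
qed


section \<open>Extending patterns in strongly irreducible subshifts of finite type\<close>

text \<open>
  \<open>E\<close> is the union of the translates of the domains of forbidden patterns that meet \<open>K\<close>. A
  forbidden pattern in the glued configuration would thus lie in \<open>E\<close> and occur in \<open>x\<close>, or miss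
  \<open>K\<close> and occur in \<open>z\<close>.
\<close>

lemma finite_type_glue:
  assumes fin: "finite (origin_stabilizer R)" and H: "H \<subseteq> carrier (grp R)"
    and X: "subshift_of_finite_type R H Q X"
    and K: "finite K" "K \<subseteq> cells R"
  obtains E where "finite E" "E \<subseteq> cells R"
    "\<And>x z. x \<in> X \<Longrightarrow> z \<in> X \<Longrightarrow> (\<And>m. m \<in> E - K \<Longrightarrow> x m = z m) \<Longrightarrow>
       (\<lambda>m. if m \<in> K then x m else z m) \<in> X"
proof -
  obtain \<FF> where \<FF>: "finite \<FF>" "\<FF> \<subseteq> finite_patterns R Q" "X = avoiding R H Q \<FF>"
    using X by (auto simp: subshift_of_finite_type_def)
  have dom: "finite (dom f)" "dom f \<subseteq> cells R" if "f \<in> \<FF>" for f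
    using that \<FF>(2) by (auto simp: finite_patterns_def patterns_def)
  let ?T = "\<lambda>k n. {h \<in> carrier (grp R). act R h n = k}"
  let ?E = "\<Union>f\<in>\<FF>. \<Union>k\<in>K. \<Union>n\<in>dom f. \<Union>h\<in>?T k n. act R h ` dom f"
  show thesis
  proof
    show "finite ?E"
      by (intro finite_UN_I finite_imageI finite_transporter fin dom(1) \<FF>(1) K(1))
        (use K(2) dom(2) in blast)+
    show "?E \<subseteq> cells R"
      using dom act_closed by blast
  next
    fix x z assume x: "x \<in> X" and z: "z \<in> X" and eq: "\<And>m. m \<in> ?E - K \<Longrightarrow> x m = z m"
    let ?y = "\<lambda>m. if m \<in> K then x m else z m"
    have conf: "x \<in> configurations R Q" "z \<in> configurations R Q"
      using x z \<FF>(3) by (auto simp: avoiding_def)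
    then have yc: "?y \<in> configurations R Q"
      unfolding configurations_iff by simp
    then have dy: "dom ?y = cells R"
      by (simp only: configurations_def mem_Collect_eq)
    have "\<not> semi_occurs R H f ?y" if f: "f \<in> \<FF>" for f
    proof
      assume "semi_occurs R H f ?y"
      then obtain h where h: "h \<in> H" "act R h ` dom f \<subseteq> cells R"
        "shift R h f = ?y |` (act R h ` dom f)"
        unfolding semi_occurs_def dy by blast
      have "\<exists>w\<in>X. \<forall>m\<in>act R h ` dom f. ?y m = w m"
      proof (cases "act R h ` dom f \<inter> K = {}")
        case True
        then show ?thesis using z by (intro bexI[of _ z]) auto
      next
        case False
        then obtain n where n: "n \<in> dom f" "act R h n \<in> K" by blast
        have hT: "h \<in> ?T (act R h n) n" using h(1) H by blast
        have "?y m = x m" if "m \<in> act R h ` dom f" for m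
        proof (cases "m \<in> K")
          case False
          have "m \<in> ?E" by (rule UN_I, rule f, rule UN_I, rule n(2), rule UN_I, rule n(1),
                rule UN_I, rule hT, rule that)
          with False show ?thesis using eq by simp
        qed simp
        with x show ?thesis by blast
      qed
      then obtain w where w: "w \<in> X" "\<forall>m\<in>act R h ` dom f. ?y m = w m" by blast
      \<comment> \<open>An occurrence of \<open>f\<close> by way of \<open>h\<close> depends only on
        the values on the translated domain, so it passes to \<open>w\<close>, which avoids all
        forbidden patterns.\<close>
      then have "?y |` (act R h ` dom f) = w |` (act R h ` dom f)"
        unfolding restrict_map_def by (intro ext if_cong refl) (rule bspec)
      moreover have "dom w = cells R"
        using w \<FF>(3) by (auto simp: avoiding_def configurations_def)
      ultimately have "semi_occurs R H f w"
        unfolding semi_occurs_def using h by auto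
      then show False using w(1) \<FF>(3) f by (auto simp: avoiding_def)
    qed
    then show "?y \<in> X" using yc \<FF>(3) by (simp add: avoiding_def)
  qed
qed

text \<open>The identity, which lies in \<open>H\<close>, witnesses the semi-occurrence.\<close>

lemma allowed_restriction:
  assumes H: "subgroup H (grp R)" and X: "X \<subseteq> configurations R Q"
    and x: "x \<in> X" and A: "A \<subseteq> cells R"
  shows "allowed R H X (x |` A)"
proof -
  have d: "dom x = cells R" using X x by (auto simp: configurations_def)
  have im: "act R \<one>\<^bsub>grp R\<^esub> ` A = A"
    using A act_one by force
  have dA: "dom (x |` A) = A" using A d by auto
  have "shift R \<one>\<^bsub>grp R\<^esub> (x |` A) m = (x |` A) m" for m
    using A act_one[of m] unfolding shift_def dA im by (cases "m \<in> A") auto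
  then have "shift R \<one>\<^bsub>grp R\<^esub> (x |` A) = x |` A"
    by (rule ext)
  then have "semi_occurs R H (x |` A) x"
    unfolding semi_occurs_def dA using subgroup.one_closed[OF H] A
    by (intro bexI[of _ "\<one>\<^bsub>grp R\<^esub>"]) (auto simp: d im)
  then show ?thesis using x by (auto simp: allowed_def)
qed

lemma restriction_finite_pattern:
  assumes "x \<in> configurations R Q" "finite A"
  shows "x |` A \<in> finite_patterns R Q"
proof -
  have "ran (x |` A) \<subseteq> ran x" by (auto dest!: ran_restrictD intro: ranI)
  then show ?thesis
    using assms by (auto simp: finite_patterns_def patterns_def configurations_def)
qed

text \<open>Gluing along \<open>?K\<close> requires agreement only on the finite set
  \<open>E - ?K\<close>, where \<open>E\<close> depends on \<open>?K\<close> alone. Strong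
  irreducibility provides a configuration \<open>x\<close> that looks like \<open>u\<close> on
  \<open>A\<close> and like \<open>z\<close> on \<open>E - ?K\<close>.\<close>

lemma strongly_irreducible_extension:
  assumes fin: "finite (origin_stabilizer R)" "finite S" "right_generating_set R S"
    and H: "subgroup H (grp R)"
    and X: "subshift_of_finite_type R H Q X" "strongly_irreducible_with R S H Q \<kappa> X"
    and A: "finite A" "A \<subseteq> cells R" and "u \<in> X" "z \<in> X"
  obtains y where "y \<in> X" "y |` A = u |` A" "\<And>m. m \<notin> set_closure R S \<kappa> A \<Longrightarrow> y m = z m"
proof -
  let ?K = "set_closure R S \<kappa> A"
  have HG: "H \<subseteq> carrier (grp R)" using H by (rule subgroup.subset)
  obtain E where E: "finite E" "E \<subseteq> cells R" and glue: "\<And>x z. x \<in> X \<Longrightarrow> z \<in> X \<Longrightarrow>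
      (\<And>m. m \<in> E - ?K \<Longrightarrow> x m = z m) \<Longrightarrow> (\<lambda>m. if m \<in> ?K then x m else z m) \<in> X"
    using finite_type_glue[OF fin(1) HG X(1) finite_set_closure[OF fin A, of \<kappa>] set_closure_subset]
    by blast
  have conf: "X \<subseteq> configurations R Q"
    using X(1) by (auto simp: subshift_of_finite_type_def avoiding_def)
  then have "dom u = cells R" "dom z = cells R"
    using assms(9,10) by (auto simp: configurations_def)
  then have dom: "dom (z |` (E - ?K)) = E - ?K" "dom (u |` A) = A"
    using A(2) E(2) by auto
  have "enat (\<kappa> + 1) \<le> cell_dist R S a b" if "a \<in> E - ?K" "b \<in> A" for a b
  proof -
    \<comment> \<open>The radius \<open>\<kappa>\<close> of the thickening is chosen for this: a
      cell outside \<open>?K\<close> has no cell of \<open>A\<close> within distance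
      \<open>\<kappa>\<close>.\<close>
    have "\<not> cell_dist R S a b \<le> enat \<kappa>"
      using that A(2) E(2) by (auto simp: set_closure_def cell_ball_def)
    then show ?thesis by (simp add: Suc_ile_eq)
  qed
  then have dist: "enat (\<kappa> + 1) \<le> cell_setdist R S (dom (z |` (E - ?K))) (dom (u |` A))"
    unfolding dom cell_setdist_def by (auto intro!: INF_greatest)
  have "z |` (E - ?K) \<in> finite_patterns R Q" "u |` A \<in> finite_patterns R Q"
    using conf assms(9,10) A(1) E(1) by (auto intro!: restriction_finite_pattern)
  moreover have "allowed R H X (z |` (E - ?K))" "allowed R H X (u |` A)"
    using assms(9,10) A(2) E(2) by (auto intro!: allowed_restriction[OF H conf])
  ultimately have "\<exists>x\<in>X. x |` dom (z |` (E - ?K)) = z |` (E - ?K) \<and> x |` dom (u |` A) = u |` A"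
    using X(2) dist unfolding strongly_irreducible_with_def by blast
  then obtain x where x: "x \<in> X" "x |` (E - ?K) = z |` (E - ?K)" "x |` A = u |` A"
    unfolding dom by blast
  \<comment> \<open>Beyond \<open>E\<close> nothing is known about \<open>x\<close>, so it is kept
    on \<open>?K\<close> only and replaced by \<open>z\<close> elsewhere.\<close>
  let ?y = "\<lambda>m. if m \<in> ?K then x m else z m"
  have "x m = z m" if "m \<in> E - ?K" for m
    using x(2) that by (metis restrict_in)
  then have "?y \<in> X" using glue x(1) assms(10) by blast
  moreover have "?y |` A = u |` A"
    using subset_set_closure[OF A(2), of S \<kappa>] unfolding x(3)[symmetric]
    by (auto simp: restrict_map_def fun_eq_iff)
  ultimately show thesis by (intro that[of ?y]) auto
qed


section \<open>Counting patterns\<close>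

text \<open>The image at \<open>m\<close> reads only cells of the ball of radius
  \<open>\<kappa>\<close> about \<open>m\<close>, because translation by \<open>coord R m\<close>
  carries the ball about the origin into it. Outside the thickening of \<open>K\<close> this ball
  misses \<open>K\<close>.\<close>

lemma local_map_agree:
  assumes S: "right_generating_set R S" and \<Delta>: "local_map_with R S H Q \<kappa> X Y \<Delta>"
    and Y: "Y \<subseteq> configurations R Q"
    and x: "x \<in> X" "y \<in> X" and eq: "\<And>m. m \<notin> K \<Longrightarrow> x m = y m"
    and m: "m \<notin> set_closure R S \<kappa> K"
  shows "\<Delta> x m = \<Delta> y m"
proof (cases "m \<in> cells R")
  case True
  obtain N \<delta> where N: "N \<subseteq> cell_ball R S (origin R) \<kappa>"
    and \<delta>: "\<forall>x\<in>X. \<forall>m\<in>cells R.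
      \<Delta> x m = Some (\<delta> (\<lambda>n. if n \<in> N then x (m \<triangleleft>\<^bsub>R\<^esub> coset_of_cell R n) else None))"
    using \<Delta> unfolding local_map_with_def by (elim conjE exE)
  have "x (m \<triangleleft>\<^bsub>R\<^esub> coset_of_cell R n) = y (m \<triangleleft>\<^bsub>R\<^esub> coset_of_cell R n)" if n: "n \<in> N" for n
  proof -
    have nc: "n \<in> cells R" "cell_dist R S (origin R) n \<le> enat \<kappa>"
      using n N by (auto simp: cell_ball_def)
    have "act R (coord R m) n \<in> cell_ball R S m \<kappa>"
      using cell_dist_act[OF S coord_closed[OF True] nc(2)] True nc(1)
      by (simp add: cell_ball_def coord_act act_closed coord_closed)
    then have "act R (coord R m) n \<notin> K"
      using m True by (auto simp: set_closure_def)
    then show ?thesis using eq True nc(1) by (simp add: right_act_coset_of_cell)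
  qed
  then have "(\<lambda>n. if n \<in> N then x (m \<triangleleft>\<^bsub>R\<^esub> coset_of_cell R n) else None) =
      (\<lambda>n. if n \<in> N then y (m \<triangleleft>\<^bsub>R\<^esub> coset_of_cell R n) else None)"
    by auto
  then show ?thesis using \<delta> x True by simp
next
  case False
  \<comment> \<open>Off \<open>cells R\<close> both images are \<open>None\<close>, being
    configurations.\<close>
  have "\<Delta> x \<in> configurations R Q" "\<Delta> y \<in> configurations R Q"
    using \<Delta> x Y unfolding local_map_with_def by blast+
  then show ?thesis using False by (simp add: configurations_iff)
qed

end

lemma finite_restrictions:
  assumes "X \<subseteq> configurations R Q" "finite Q" "finite A" "A \<subseteq> cells R"
  shows "finite (restrictions X A)"
proof (rule finite_subset)
  show "restrictions X A \<subseteq> {p. dom p = A \<and> ran p \<subseteq> Q}"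
  proof
    fix p assume "p \<in> restrictions X A"
    then obtain x where x: "x \<in> X" "p = x |` A" by (auto simp: restrictions_def)
    then have "dom x = cells R" "ran x \<subseteq> Q"
      using assms(1) by (auto simp: configurations_def patterns_def)
    then show "p \<in> {p. dom p = A \<and> ran p \<subseteq> Q}"
      using assms(4) x(2) by (auto dest!: ran_restrictD intro: ranI)
  qed
  show "finite {p. dom p = A \<and> ran p \<subseteq> Q}"
    using assms by (intro finite_set_of_finite_maps)
qed

text \<open>A pattern on \<open>B\<close> is determined by its restriction to \<open>A\<close>
  together with one symbol of \<open>Q\<close> for each cell of \<open>B - A\<close>.\<close>

lemma card_restrictions_le:
  assumes X: "X \<subseteq> configurations R Q" and Q: "finite Q"
    and B: "finite B" "B \<subseteq> cells R" and AB: "A \<subseteq> B"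
  shows "card (restrictions X B) \<le> card (restrictions X A) * card Q ^ card (B - A)"
proof -
  let ?D = "restrictions X A \<times> (B - A \<rightarrow>\<^sub>E Q)"
  let ?f = "\<lambda>(p, f) m. if m \<in> A then p m else if m \<in> B then Some (f m) else None"
  have finA: "finite (restrictions X A)"
    using finite_restrictions[OF X Q] B AB by (meson finite_subset subset_trans)
  have "restrictions X B \<subseteq> ?f ` ?D"
  proof
    fix p assume "p \<in> restrictions X B"
    then obtain x where x: "x \<in> X" "p = x |` B" by (auto simp: restrictions_def)
    have Some: "\<exists>q\<in>Q. x m = Some q" if "m \<in> B" for m
    proof -
      have "m \<in> cells R" using B(2) that by blast
      moreover have "x \<in> configurations R Q" using X x(1) by blast
      ultimately show ?thesis unfolding configurations_iff by metis
    qed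
    have "x |` A \<in> restrictions X A" using x(1) by (auto simp: restrictions_def)
    moreover have "restrict (\<lambda>m. the (x m)) (B - A) \<in> B - A \<rightarrow>\<^sub>E Q"
    proof (rule restrict_PiE_iff[THEN iffD2], rule ballI)
      fix m assume "m \<in> B - A"
      then show "the (x m) \<in> Q" using Some[of m] by auto
    qed
    moreover have "p m = ?f (x |` A, restrict (\<lambda>m. the (x m)) (B - A)) m" for m
      using Some[of m] AB x(2) by (auto simp: restrict_map_def)
    then have "p = ?f (x |` A, restrict (\<lambda>m. the (x m)) (B - A))"
      by (rule ext)
    ultimately show "p \<in> ?f ` ?D" by blast
  qed
  then have "card (restrictions X B) \<le> card ?D"
    using finA Q B(1) by (intro surj_card_le finite_cartesian_product finite_PiE) auto
  also have "\<dots> = card (restrictions X A) * card Q ^ card (B - A)"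
    using B(1) by (simp add: card_cartesian_product card_PiE)
  finally show ?thesis .
qed

text \<open>Each pattern \<open>p\<close> is extended to some \<open>e p\<close> in
  \<open>X\<close>, with one background \<open>z\<close> common to all of them. Mapping
  \<open>p\<close> to the restriction of \<open>\<Delta> (e p)\<close> to \<open>?B\<close> is
  injective by pre-injectivity, since \<open>e p\<close> restricts to \<open>p\<close> on
  \<open>A\<close>.\<close>

lemma (in cell_space) card_restrictions_le_image:
  assumes fin: "finite (origin_stabilizer R)" "finite S" "right_generating_set R S"
    and H: "subgroup H (grp R)" and Q: "finite Q"
    and X: "subshift_of_finite_type R H Q X" "strongly_irreducible_with R S H Q \<kappa> X"
    and Y: "Y \<subseteq> configurations R Q" and \<Delta>: "local_map_with R S H Q \<eta> X Y \<Delta>"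
    and inj: "pre_injective R X \<Delta>"
    and A: "finite A" "A \<subseteq> cells R"
  shows "card (restrictions X A) \<le> card (restrictions (\<Delta> ` X) (set_closure R S (\<eta> + \<kappa>) A))"
proof (cases "X = {}")
  case False
  then obtain z where z: "z \<in> X" by blast
  let ?K = "set_closure R S \<kappa> A" and ?B = "set_closure R S (\<eta> + \<kappa>) A"
  have "\<exists>y\<in>X. y |` A = p \<and> (\<forall>m. m \<notin> ?K \<longrightarrow> y m = z m)" if "p \<in> restrictions X A" for p
  proof -
    obtain u where u: "u \<in> X" "p = u |` A"
      using \<open>p \<in> restrictions X A\<close> unfolding restrictions_def by blast
    obtain y where "y \<in> X" "y |` A = u |` A" "\<And>m. m \<notin> ?K \<Longrightarrow> y m = z m"
      using strongly_irreducible_extension[OF fin H X A u(1) z] by blast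
    then show ?thesis using u(2) by blast
  qed
  then obtain e where e: "\<And>p. p \<in> restrictions X A \<Longrightarrow> e p \<in> X \<and> e p |` A = p"
    and ez: "\<And>p m. p \<in> restrictions X A \<Longrightarrow> m \<notin> ?K \<Longrightarrow> e p m = z m"
    by metis
  have "inj_on (\<lambda>p. \<Delta> (e p) |` ?B) (restrictions X A)"
  proof (rule inj_onI)
    fix p q assume pq: "p \<in> restrictions X A" "q \<in> restrictions X A"
      and eq: "\<Delta> (e p) |` ?B = \<Delta> (e q) |` ?B"
    have off: "e p m = e q m" if "m \<notin> ?K" for m
      using ez pq that by simp
    have "\<Delta> (e p) m = \<Delta> (e q) m" for m
    proof (cases "m \<in> ?B")
      case True
      then show ?thesis using eq by (metis restrict_in)
    next
      case False
      \<comment> \<open>The extensions differ only inside \<open>?K\<close>, so their images can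
        differ only within distance \<open>\<eta>\<close> of \<open>?K\<close>, hence inside
        \<open>?B\<close>.\<close>
      then have "m \<notin> set_closure R S \<eta> ?K"
        using set_closure_set_closure[of R S \<eta> \<kappa> A] by blast
      with off show ?thesis
        using e pq by (intro local_map_agree[OF fin(3) \<Delta> Y, where K = ?K]) auto
    qed
    then have "\<Delta> (e p) = \<Delta> (e q)" by blast
    \<comment> \<open>Pre-injectivity speaks only of configurations with finitely many differences;
      these lie in the finite set \<open>?K\<close>.\<close>
    moreover have "{m \<in> cells R. e p m \<noteq> e q m} \<subseteq> ?K"
      using off by blast
    then have "finite {m \<in> cells R. e p m \<noteq> e q m}"
      using finite_set_closure[OF fin A] by (rule finite_subset)
    ultimately have "e p = e q"
      using inj e pq unfolding pre_injective_def by blast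
    then show "p = q" using e pq by metis
  qed
  moreover have "(\<lambda>p. \<Delta> (e p) |` ?B) ` restrictions X A \<subseteq> restrictions (\<Delta> ` X) ?B"
    using e by (auto simp: restrictions_def)
  moreover have "\<Delta> ` X \<subseteq> configurations R Q"
    using \<Delta> Y by (auto simp: local_map_with_def)
  then have "finite (restrictions (\<Delta> ` X) ?B)"
    using finite_set_closure[OF fin A] set_closure_subset Q by (intro finite_restrictions)
  ultimately show ?thesis by (rule card_inj_on_le)
qed (simp add: restrictions_def)


section \<open>Comparison of entropies\<close>

text \<open>By reflexivity each tail contains its own starting index.\<close>

lemma net_filter_neq_bot: "directed_set I r \<Longrightarrow> net_filter I r \<noteq> bot"
  unfolding trivial_limit_def eventually_net_filter
  by (auto simp: directed_set_def preorder_on_def dest: refl_onD)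

lemma eventually_net_filter_in:
  assumes "directed_set I r"
  shows "eventually (\<lambda>i. i \<in> I) (net_filter I r)"
  unfolding eventually_net_filter[OF assms] using assms by (auto simp: directed_set_def)

text \<open>Eventually \<open>c i\<close> is below any given real \<open>e > 0\<close>, and a
  constant real summand can be pulled out of the limit superior even when that is infinite.\<close>

lemma Limsup_le_add_tendsto_zero:
  fixes u v :: "'a \<Rightarrow> ereal"
  assumes "F \<noteq> bot" "(c \<longlongrightarrow> 0) F" "eventually (\<lambda>i. u i \<le> v i + ereal (c i)) F"
  shows "Limsup F u \<le> Limsup F v"
proof (rule ereal_le_epsilon2)
  fix e :: real assume "0 < e"
  have "eventually (\<lambda>i. c i < e) F"
    using assms(2) \<open>0 < e\<close> by (rule order_tendstoD)
  with assms(3) have "eventually (\<lambda>i. u i \<le> v i + ereal e) F"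
    by eventually_elim (meson add_left_mono ereal_less_eq(3) less_imp_le order_trans)
  then have "Limsup F u \<le> Limsup F (\<lambda>i. v i + ereal e)"
    by (rule Limsup_mono)
  also have "\<dots> = Limsup F v + ereal e"
    using assms(1) by (simp add: Limsup_add_ereal_right)
  finally show "Limsup F u \<le> Limsup F v + ereal e" .
qed

text \<open>After taking logarithms and dividing by \<open>card (F i)\<close>, the two counting
  bounds differ from the desired inequality by \<open>?c i\<close>, a multiple of the relative size
  of the boundary of \<open>F i\<close>, which tends to 0 along the net.\<close>

lemma entropy_le_image:
  assumes R: "cell_space R"
    and fin: "finite (origin_stabilizer R)" "finite S" "right_generating_set R S"
    and H: "subgroup H (grp R)" and Q: "finite Q"
    and F: "right_Folner_net R S I r F"
    and X: "subshift_of_finite_type R H Q X" "strongly_irreducible_with R S H Q \<kappa> X"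
    and Y: "Y \<subseteq> configurations R Q" and \<Delta>: "local_map_with R S H Q \<eta> X Y \<Delta>"
    and inj: "pre_injective R X \<Delta>"
  shows "entropy I r F X \<le> entropy I r F (\<Delta> ` X)"
proof (cases "X = {}")
  case False
  interpret cell_space R by (rule R)
  let ?N = "net_filter I r"
  let ?D = "\<lambda>i. set_boundary R S (\<eta> + \<kappa>) (F i)"
  let ?c = "\<lambda>i. real (card (?D i)) / real (card (F i)) * ln (real (card Q))"
  have dir: "directed_set I r" using F by (simp add: right_Folner_net_def)
  have conf: "X \<subseteq> configurations R Q" "\<Delta> ` X \<subseteq> configurations R Q"
    using X(1) \<Delta> Y by (auto simp: subshift_of_finite_type_def avoiding_def local_map_with_def)
  have "Q \<noteq> {}"
  proof
    assume "Q = {}"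
    obtain x where "x \<in> configurations R Q" using conf(1) False by blast
    then have "\<exists>q\<in>Q. x (origin R) = Some q"
      using origin_closed unfolding configurations_iff by metis
    with \<open>Q = {}\<close> show False by blast
  qed
  \<comment> \<open>This permits enlarging the exponent of \<open>card Q\<close> from
    \<open>card (?B - F i)\<close> to \<open>card (?D i)\<close> and taking the logarithm of the
    power.\<close>
  then have Q1: "card Q \<ge> 1" using Q by (simp add: Suc_le_eq card_gt_0_iff)
  have "(?c \<longlongrightarrow> 0 * ln (real (card Q))) ?N"
    using F by (intro tendsto_mult tendsto_const) (simp add: right_Folner_net_def)
  then have lim: "(?c \<longlongrightarrow> 0) ?N" by simp
  have le: "log_card (restrictions X (F i)) / ereal (real (card (F i)))
      \<le> log_card (restrictions (\<Delta> ` X) (F i)) / ereal (real (card (F i))) + ereal (?c i)"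
    if i: "i \<in> I" for i
  proof -
    let ?B = "set_closure R S (\<eta> + \<kappa>) (F i)"
    have Fi: "F i \<noteq> {}" "finite (F i)" "F i \<subseteq> cells R"
      using F i by (auto simp: right_Folner_net_def)
    have finB: "finite ?B" using Fi by (intro finite_set_closure fin)
    \<comment> \<open>The interior lies in \<open>F i\<close>, so the cells added by thickening
      belong to the boundary; the second inclusion makes the boundary finite.\<close>
    have sub: "?B - F i \<subseteq> ?D i" "?D i \<subseteq> ?B"
      by (auto simp: set_boundary_def set_interior_def)
    have "card (restrictions X (F i)) \<le> card (restrictions (\<Delta> ` X) ?B)"
      using Fi by (intro card_restrictions_le_image[OF fin H Q X Y \<Delta> inj])
    also have "\<dots> \<le> card (restrictions (\<Delta> ` X) (F i)) * card Q ^ card (?B - F i)"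
      using Fi finB by (intro card_restrictions_le[OF conf(2) Q] set_closure_subset subset_set_closure)
    also have "\<dots> \<le> card (restrictions (\<Delta> ` X) (F i)) * card Q ^ card (?D i)"
      using Q1 sub finB by (intro mult_left_mono power_increasing card_mono) (auto dest: finite_subset)
    finally have "real (card (restrictions X (F i)))
        \<le> real (card (restrictions (\<Delta> ` X) (F i))) * real (card Q) ^ card (?D i)"
      by (metis of_nat_le_iff of_nat_mult of_nat_power)
    \<comment> \<open>Nonemptiness excludes the value minus infinity of \<open>log_card\<close> and
      makes the real logarithms comparable.\<close>
    moreover have ne: "restrictions X (F i) \<noteq> {}" "restrictions (\<Delta> ` X) (F i) \<noteq> {}"
      using False by (auto simp: restrictions_def)
    then have pos: "card (restrictions X (F i)) > 0" "card (restrictions (\<Delta> ` X) (F i)) > 0"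
      using finite_restrictions[OF _ Q Fi(2,3)] conf by (auto simp: card_gt_0_iff)
    ultimately have "ln (real (card (restrictions X (F i))))
        \<le> ln (real (card (restrictions (\<Delta> ` X) (F i))) * real (card Q) ^ card (?D i))"
      by simp
    also have "\<dots> = ln (real (card (restrictions (\<Delta> ` X) (F i))))
        + real (card (?D i)) * ln (real (card Q))"
      using pos Q1 by (simp add: ln_mult ln_realpow)
    finally have "ln (real (card (restrictions X (F i)))) / real (card (F i))
        \<le> ln (real (card (restrictions (\<Delta> ` X) (F i)))) / real (card (F i)) + ?c i"
      by (simp add: divide_right_mono flip: add_divide_distrib)
    moreover have "real (card (F i)) \<noteq> 0" using Fi by simp
    ultimately show ?thesis
      using ne by (simp add: log_card_def)
  qed
  show ?thesis
    unfolding entropy_def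
    using net_filter_neq_bot[OF dir] lim eventually_mono[OF eventually_net_filter_in[OF dir] le]
    by (rule Limsup_le_add_tendsto_zero)
qed simp

theorem theorem4p3:
  fixes R :: "('g, 'm) cell_space_data"
    and S :: "'g set set"
    and H :: "'g set"
    and Q :: "'q set"
    and I :: "'i set"
    and r :: "'i rel"
    and F :: "'i \<Rightarrow> 'm set"
    and X Y :: "('m \<rightharpoonup> 'q) set"
    and \<Delta> :: "('m \<rightharpoonup> 'q) \<Rightarrow> ('m \<rightharpoonup> 'q)"
  assumes "cell_space R"
    and "finite (origin_stabilizer R)"
    and "finite S" and "symmetric_set R S" and "right_generating_set R S"
    and "subgroup H (grp R)" and "\<forall>m \<in> cells R. coord R m \<in> H"
    and "finite Q"
    and "right_amenable R"
    and "right_Folner_net R S I r F"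
    and "subshift_of_finite_type R H Q X" and "strongly_irreducible R S H Q X"
    and "subshift R H Q Y"
    and "local_map R S H Q X Y \<Delta>"
    and "entropy I r F (\<Delta> ` X) < entropy I r F X"
  shows "\<not> pre_injective R X \<Delta>"
proof
  assume inj: "pre_injective R X \<Delta>"
  obtain \<kappa> where "strongly_irreducible_with R S H Q \<kappa> X"
    using assms(12) by (auto simp: strongly_irreducible_def)
  moreover obtain \<eta> where "local_map_with R S H Q \<eta> X Y \<Delta>"
    using assms(14) by (auto simp: local_map_def)
  moreover have "Y \<subseteq> configurations R Q"
    using assms(13) by (auto simp: subshift_def avoiding_def)
  ultimately have "entropy I r F X \<le> entropy I r F (\<Delta> ` X)"
    using assms inj by (intro entropy_le_image)
  with assms(15) show False by simp
qed

end
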